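(* Let $m\geqslant 3$ and $n\geqslant 3$ be distinct odd integers. Then the number of distinct $C_4$-face-magic projective labelings on $\mathcal{P}_{m,n}$ with $C_4$-face-magic value $2mn+1$, counted up to symmetries of the projective plane, is at least $\bigl(\tau(m,n)+\tau(n,m)\bigr)\,2^{m/2+n/2-3}\,\beta(m)\,\beta(n)$; the same lower bound holds for the number of those with $C_4$-face-magic value $2mn+3$.
   Context: $\mathcal{P}_{m,n}$ has vertices $(i,j)$, $1\leqslant i\leqslant m$, $1\leqslant j\leqslant n$, and edges $(i,j)$–$(i,j+1)$ ($j\leqslant n-1$), $(i,n)$–$(m+1-i,1)$, $(i,j)$–$(i+1,j)$ ($i\leqslant m-1$), $(m,j)$–$(1,n+1-j)$, embedded naturally in the projective plane. Its 4-cycle faces are $\{(i,j),(i+1,j),(i,j+1),(i+1,j+1)\}$ ($1\leqslant i\leqslant m-1$, $1\leqslant j\leqslant n-1$), $\{(i,n),(i+1,n),(m+1-i,1),(m-i,1)\}$ ($1\leqslant i\leqslant m-1$), $\{(m,j),(m,j+1),(1,n+1-j),(1,n-j)\}$ ($1\leqslant j\leqslant n-1$); the other two faces are digons. A $C_4$-face-magic projective labeling is a bijection from the vertices onto $\{1,\ldots,mn\}$ such that every 4-cycle face has the same label sum, the $C_4$-face-magic value. For $m\neq n$ the symmetries of $\mathcal{P}_{m,n}$ are the four automorphisms $(i,j)\mapsto(i,j)$, $(i,j)\mapsto(m+1-i,n+1-j)$, $(i,j)\mapsto(i,n+1-j)$, $(i,j)\mapsto(m+1-i,j)$; labelings are counted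 up to precomposition with these. For positive integer $k$, an $(m,n)$-projective factorization sequence is a tuple $(m_1,n_1,\ldots,m_k,n_k)$ of integers $>1$ with $m=m_1\cdots m_k$, $n=n_1\cdots n_k$, or a tuple $(m_1,n_1,\ldots,m_k,n_k,m_{k+1})$ of integers $>1$ with $m=m_1\cdots m_{k+1}$, $n=n_1\cdots n_k$; $\tau(m,n)$ is the number of distinct $(m,n)$-projective factorization sequences (of all lengths), and $\tau(n,m)$ is defined with the roles of $m$ and $n$ exchanged. For odd $m\geqslant3$, $\beta(m)=\bigl((\tfrac{m-1}{4})!\bigr)^2$ if $m\equiv1\pmod4$ and $\beta(m)=(\tfrac{m-3}{4})!\,(\tfrac{m+1}{4})!$ if $m\equiv3\pmod4$. *)

theory Defs
  imports Main "HOL-Library.FuncSet"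
begin

definition proj_vertices :: "nat \<Rightarrow> nat \<Rightarrow> (nat \<times> nat) set" where
  "proj_vertices m n = {1..m} \<times> {1..n}"

(* The embedding of the projective grid graph enters only through its 4-cycle faces:
   the interior squares, followed by the squares crossing the two twisted seams
   (i,n) -- (m+1-i,1) and (m,j) -- (1,n+1-j).  The two digon faces are not listed.
   All subtractions are exact in the stated index ranges. *)
definition proj_C4_faces :: "nat \<Rightarrow> nat \<Rightarrow> (nat \<times> nat) set set" where
  "proj_C4_faces m n =
     {{(i, j), (i + 1, j), (i, j + 1), (i + 1, j + 1)} | i j.
        i \<in> {1..m - 1} \<and> j \<in> {1..n - 1}} \<union>
     {{(i, n), (i + 1, n), (m + 1 - i, 1), (m - i, 1)} | i. i \<in> {1..m - 1}} \<union>
     {{(m, j), (m, j + 1), (1, n + 1 - j), (1, n - j)} | j. j \<in> {1..n - 1}}"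

(* Labelings are taken to be extensional (undefined outside the vertex set), so that
   two of them are equal iff they agree on all vertices. *)
definition C4_face_magic_labelings :: "nat \<Rightarrow> nat \<Rightarrow> nat \<Rightarrow> (nat \<times> nat \<Rightarrow> nat) set" where
  "C4_face_magic_labelings m n S =
     {f \<in> extensional (proj_vertices m n).
        bij_betw f (proj_vertices m n) {1..m * n} \<and>
        (\<forall>F \<in> proj_C4_faces m n. (\<Sum>v\<in>F. f v) = S)}"

(* The symmetries for m \<noteq> n; the square case has further ones. *)
definition proj_symmetries :: "nat \<Rightarrow> nat \<Rightarrow> (nat \<times> nat \<Rightarrow> nat \<times> nat) set" where
  "proj_symmetries m n =
     {\<lambda>(i, j). (i, j),
      \<lambda>(i, j). (m + 1 - i, n + 1 - j),
      \<lambda>(i, j). (i, n + 1 - j),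
      \<lambda>(i, j). (m + 1 - i, j)}"

definition labeling_equiv ::
  "nat \<Rightarrow> nat \<Rightarrow> nat \<Rightarrow> ((nat \<times> nat \<Rightarrow> nat) \<times> (nat \<times> nat \<Rightarrow> nat)) set" where
  "labeling_equiv m n S =
     {(f, g). f \<in> C4_face_magic_labelings m n S \<and> g \<in> C4_face_magic_labelings m n S \<and>
        (\<exists>\<sigma> \<in> proj_symmetries m n. \<forall>v \<in> proj_vertices m n. g v = f (\<sigma> v))}"

definition num_C4_face_magic_labelings :: "nat \<Rightarrow> nat \<Rightarrow> nat \<Rightarrow> nat" where
  "num_C4_face_magic_labelings m n S =
     card (C4_face_magic_labelings m n S // labeling_equiv m n S)"

(* The tuple (m_1, n_1, m_2, n_2, ...) is a list indexed from 0: m_(i+1) is entry 2 * i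
   and n_(i+1) is entry 2 * i + 1. *)
definition proj_factorization_seqs :: "nat \<Rightarrow> nat \<Rightarrow> nat list set" where
  "proj_factorization_seqs m n =
     {xs. (\<forall>x \<in> set xs. x > 1) \<and>
        (\<exists>k \<ge> 1.
           (length xs = 2 * k \<and>
              m = (\<Prod>i<k. xs ! (2 * i)) \<and> n = (\<Prod>i<k. xs ! (2 * i + 1))) \<or>
           (length xs = 2 * k + 1 \<and>
              m = (\<Prod>i<k + 1. xs ! (2 * i)) \<and> n = (\<Prod>i<k. xs ! (2 * i + 1))))}"

definition tau :: "nat \<Rightarrow> nat \<Rightarrow> nat" where
  "tau m n = card (proj_factorization_seqs m n)"

(* Only meaningful for odd m \<ge> 3, where the divisions are exact. *)
definition beta :: "nat \<Rightarrow> nat" where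
  "beta m =
     (if m mod 4 = 1 then (fact ((m - 1) div 4))\<^sup>2
      else fact ((m - 3) div 4) * fact ((m + 1) div 4))"

end

theory Submission
  imports Defs "HOL-Combinatorics.Permutations"
begin

text \<open>
  Write \<open>H = (mn - 1) / 2\<close> and index rows and columns by their offsets \<open>u, v\<close> from the centre.
  Suppose \<open>A\<close> and \<open>B\<close> are symmetric sets of integers of sizes \<open>m\<close> and \<open>n\<close> such that every integer
  in \<open>[-H, H]\<close> is uniquely \<open>a + b\<close> with \<open>a\<close> in \<open>A\<close> and \<open>b\<close> in \<open>B\<close>, and let \<open>P\<close> and \<open>Q\<close> be
  odd, parity-preserving bijections from the offsets onto \<open>A\<close> and \<open>B\<close>. Then
  \<open>c = H + P u + Q v\<close> runs through \<open>0, \<dots>, mn - 1\<close> with parities alternating like a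
  chessboard, and sending even \<open>c\<close> to \<open>c / 2 + 1\<close> and odd \<open>c\<close> to \<open>mn - (c - 1) / 2\<close> gives a labeling
  of value \<open>2mn + 3\<close>: on each face the two even and the two odd values of \<open>c\<close> have the same
  sum (across the seams because \<open>P\<close> and \<open>Q\<close> are odd). Complementing the labels gives \<open>2mn + 1\<close>.

  Mixed-radix expansions turn every factorization sequence into such a pair \<open>(A, B)\<close>, from which
  the sequence can be recovered. For given \<open>(A, B)\<close> there are \<open>2 ^ ((m - 1) / 2) \<beta>(m)\<close> choices of
  \<open>P\<close> and \<open>2 ^ ((n - 1) / 2) \<beta>(n)\<close> choices of \<open>Q\<close>, all giving different labelings, and each
  class modulo the symmetries contains at most four labelings.
\<close>

subsection \<open>Symmetric tilings of intervals\<close>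

definition sym_interval :: "nat \<Rightarrow> int set" where
  "sym_interval h = {- int h..int h}"

lemma finite_sym_interval [simp]: "finite (sym_interval h)"
  by (simp add: sym_interval_def)

lemma card_sym_interval [simp]: "card (sym_interval h) = 2 * h + 1"
  by (simp add: sym_interval_def)

text \<open>Since \<open>f = 2 * h + 1\<close>, the digit \<open>k\<close> is the residue of least
  absolute value of \<open>k + f * a\<close> modulo \<open>f\<close>; cancelling it leaves
  \<open>a\<close>.\<close>

lemma mixed_radix_eq_iff:
  fixes k k' a a' :: int
  assumes "k \<in> sym_interval h" "k' \<in> sym_interval h" "f = 2 * h + 1"
  shows "k + int f * a = k' + int f * a' \<longleftrightarrow> k = k' \<and> a = a'"
proof
  assume eq: "k + int f * a = k' + int f * a'"
  \<comment> \<open>Shifting by \<open>h\<close> moves the balanced digits to 0, ..., f - 1, where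
    \<open>mod\<close> leaves them unchanged.\<close>
  have "k = (k + int f * a + int h) mod int f - int h" if "k \<in> sym_interval h" for k a
  proof -
    have "(k + int f * a + int h) mod int f = (k + int h) mod int f"
      by (metis add.commute add.left_commute mod_mult_self2)
    then show ?thesis
      using that assms(3) by (simp add: sym_interval_def)
  qed
  from this[OF assms(1), of a] this[OF assms(2), of a'] eq have "k = k'"
    by simp
  with eq assms(3) show "k = k' \<and> a = a'"
    by simp
qed simp

text \<open>Injective by uniqueness of the digit, and into the interval by the triangle inequality;
  (2h + 1)(2H + 1) = 2(h + fH) + 1 then forces surjectivity.\<close>

lemma bij_betw_mixed_radix:
  assumes "f = 2 * h + 1"
  shows "bij_betw (\<lambda>(k, a). k + int f * a) (sym_interval h \<times> sym_interval H)
           (sym_interval (h + f * H))"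
proof -
  let ?g = "\<lambda>(k, a). k + int f * a"
  have inj: "inj_on ?g (sym_interval h \<times> sym_interval H)"
    using mixed_radix_eq_iff[OF _ _ assms] by (auto simp: inj_on_def)
  have "?g ` (sym_interval h \<times> sym_interval H) \<subseteq> sym_interval (h + f * H)"
  proof clarify
    fix k a assume "k \<in> sym_interval h" "a \<in> sym_interval H"
    then have "\<bar>k\<bar> \<le> int h" "\<bar>a\<bar> \<le> int H"
      by (auto simp: sym_interval_def)
    moreover from this have "int f * \<bar>a\<bar> \<le> int f * int H"
      by (intro mult_left_mono) auto
    moreover have "\<bar>k + int f * a\<bar> \<le> \<bar>k\<bar> + int f * \<bar>a\<bar>"
      by (metis abs_triangle_ineq abs_mult abs_of_nat)
    ultimately have "\<bar>k + int f * a\<bar> \<le> int (h + f * H)"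
      by simp
    then show "k + int f * a \<in> sym_interval (h + f * H)"
      by (auto simp: sym_interval_def)
  qed
  moreover have "card (sym_interval (h + f * H))
      = card (?g ` (sym_interval h \<times> sym_interval H))"
    unfolding card_image[OF inj] using assms by (simp add: card_cartesian_product algebra_simps)
  ultimately show ?thesis
    using inj card_subset_eq[OF finite_sym_interval] unfolding bij_betw_def by metis
qed

text \<open>Balanced mixed-radix expansion, least significant digit first: radices at even positions
  of the list build the first set, the others the second. The swap in the recursion realises this
  alternation.\<close>

fun tiling_pair :: "nat list \<Rightarrow> int set \<times> int set" where
  "tiling_pair [] = ({0}, {0})"
| "tiling_pair (f # xs) =
     ((\<lambda>(k, a). k + int f * a) ` (sym_interval (f div 2) \<times> snd (tiling_pair xs)),
      (*) (int f) ` fst (tiling_pair xs))"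

definition symmetric_tiling :: "nat \<Rightarrow> int set \<Rightarrow> int set \<Rightarrow> bool" where
  "symmetric_tiling H A B \<longleftrightarrow>
     (\<forall>a\<in>A. - a \<in> A) \<and> (\<forall>b\<in>B. - b \<in> B) \<and>
     bij_betw (\<lambda>(a, b). a + b) (A \<times> B) (sym_interval H)"

lemma symmetric_tiling_commute:
  "symmetric_tiling H A B \<Longrightarrow> symmetric_tiling H B A"
proof -
  assume t: "symmetric_tiling H A B"
  have "bij_betw prod.swap (B \<times> A) (A \<times> B)"
    by (rule bij_betwI[of _ _ _ prod.swap]) auto
  then have "bij_betw ((\<lambda>(a, b). a + b) \<circ> prod.swap) (B \<times> A) (sym_interval H)"
    using t unfolding symmetric_tiling_def by (blast intro: bij_betw_trans)
  moreover have "((\<lambda>(a, b). a + b) \<circ> prod.swap) = (\<lambda>(b, a). b + (a::int))"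
    by (auto simp: fun_eq_iff)
  ultimately show ?thesis
    using t by (simp add: symmetric_tiling_def)
qed

text \<open>Write x = k + f c with a digit k, split c = a + b by the induction hypothesis, and
  regroup as (k + f a) + f b. The swap of components is absorbed by
  \<open>symmetric_tiling_commute\<close>.\<close>

lemma symmetric_tiling_tiling_pair:
  assumes "\<forall>x\<in>set xs. odd x"
  shows "symmetric_tiling (prod_list xs div 2) (fst (tiling_pair xs)) (snd (tiling_pair xs))"
  using assms
proof (induction xs)
  case Nil
  show ?case
    by (auto simp: symmetric_tiling_def sym_interval_def bij_betw_def)
next
  case (Cons f xs)
  define h where "h = f div 2"
  define H where "H = prod_list xs div 2"
  define A where "A = snd (tiling_pair xs)"
  define B where "B = fst (tiling_pair xs)"
  have f: "f = 2 * h + 1"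
    using Cons.prems by (simp add: h_def)
  have "odd (prod_list xs)"
    using Cons.prems by (induction xs) auto
  then have H: "prod_list (f # xs) div 2 = h + f * H"
    using f by (auto simp: H_def elim!: oddE simp: algebra_simps)
  have t: "symmetric_tiling H A B"
    using Cons symmetric_tiling_commute by (simp add: H_def A_def B_def)
  let ?A = "(\<lambda>(k, a). k + int f * a) ` (sym_interval h \<times> A)" and ?B = "(*) (int f) ` B"
  let ?s = "\<lambda>(a, b). a + (b::int)" and ?g = "\<lambda>(k, a). k + int f * a"
  have tb: "bij_betw ?s (A \<times> B) (sym_interval H)"
    using t by (simp add: symmetric_tiling_def)
  have symA: "- x \<in> ?A" if x: "x \<in> ?A" for x
  proof -
    obtain k a where "x = k + int f * a" "k \<in> sym_interval h" "a \<in> A"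
      using x by auto
    then have "- x = ?g (- k, - a)" "(- k, - a) \<in> sym_interval h \<times> A"
      using t by (auto simp: symmetric_tiling_def sym_interval_def)
    then show ?thesis by blast
  qed
  have symB: "- x \<in> ?B" if "x \<in> ?B" for x
    using that t by (force simp: symmetric_tiling_def)
  have gb: "bij_betw ?g (sym_interval h \<times> sym_interval H) (sym_interval (h + f * H))"
    by (rule bij_betw_mixed_radix[OF f])
  have sum_in: "a + b \<in> sym_interval H" if "a \<in> A" "b \<in> B" for a b
    using tb that by (force simp: bij_betw_def)
  have "inj_on ?s (?A \<times> ?B)"
  proof (rule inj_onI, clarify)
    fix k a b k' a' b'
    assume in1: "k \<in> sym_interval h" "a \<in> A" "b \<in> B"
      and in2: "k' \<in> sym_interval h" "a' \<in> A" "b' \<in> B"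
      and eq: "k + int f * a + int f * b = k' + int f * a' + int f * b'"
    from eq have "k + int f * (a + b) = k' + int f * (a' + b')"
      by (simp add: algebra_simps)
    then have *: "k = k'" "a + b = a' + b'"
      using mixed_radix_eq_iff[OF in1(1) in2(1) f] by auto
    then have "(a, b) = (a', b')"
      using tb in1 in2 by (intro inj_onD[of ?s "A \<times> B"]) (auto simp: bij_betw_def)
    with * show "k + int f * a = k' + int f * a' \<and> int f * b = int f * b'"
      by simp
  qed
  moreover have "?s ` (?A \<times> ?B) = sym_interval (h + f * H)"
  proof (intro equalityI subsetI)
    fix x assume "x \<in> ?s ` (?A \<times> ?B)"
    then obtain k a b where "k \<in> sym_interval h" "a \<in> A" "b \<in> B"
      "x = k + int f * a + int f * b"
      by auto
    then have "x = ?g (k, a + b)" "(k, a + b) \<in> sym_interval h \<times> sym_interval H"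
      using sum_in by (auto simp: algebra_simps)
    then show "x \<in> sym_interval (h + f * H)"
      using gb unfolding bij_betw_def by blast
  next
    fix x assume "x \<in> sym_interval (h + f * H)"
    then obtain k c where kc: "k \<in> sym_interval h" "c \<in> sym_interval H" "x = k + int f * c"
      using gb unfolding bij_betw_def by force
    then obtain a b where ab: "a \<in> A" "b \<in> B" "c = a + b"
      using tb unfolding bij_betw_def by force
    have "x = ?s (?g (k, a), int f * b)"
      using kc ab by (simp add: algebra_simps)
    then show "x \<in> ?s ` (?A \<times> ?B)"
      using kc ab by blast
  qed
  ultimately have "symmetric_tiling (h + f * H) ?A ?B"
    using symA symB unfolding symmetric_tiling_def bij_betw_def by blast
  then show ?case
    unfolding H by (simp add: A_def B_def h_def)
qed

section \<open>Sizes of the two components\<close>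

definition even_index_prod :: "nat list \<Rightarrow> nat" where
  "even_index_prod xs = (\<Prod>i<(length xs + 1) div 2. xs ! (2 * i))"

definition odd_index_prod :: "nat list \<Rightarrow> nat" where
  "odd_index_prod xs = (\<Prod>i<length xs div 2. xs ! (2 * i + 1))"

text \<open>Removing the head shifts every index by one, so the two products trade places exactly as
  the components of \<open>tiling_pair\<close> do.\<close>

lemma even_index_prod_Cons: "even_index_prod (x # xs) = x * odd_index_prod xs"
proof -
  have "even_index_prod (x # xs) = (\<Prod>i<Suc (length xs div 2). (x # xs) ! (2 * i))"
    by (simp add: even_index_prod_def)
  also have "\<dots> = x * odd_index_prod xs"
    unfolding prod.lessThan_Suc_shift by (simp add: odd_index_prod_def)
  finally show ?thesis .
qed

lemma odd_index_prod_Cons: "odd_index_prod (x # xs) = even_index_prod xs"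
  by (simp add: odd_index_prod_def even_index_prod_def)

lemma even_index_prod_mult_odd_index_prod:
  "even_index_prod xs * odd_index_prod xs = prod_list xs"
proof (induction xs)
  case Nil
  show ?case by (simp add: even_index_prod_def odd_index_prod_def)
next
  case (Cons x xs)
  then show ?case
    by (simp add: even_index_prod_Cons odd_index_prod_Cons mult_ac)
qed

lemma card_tiling_pair:
  assumes "\<forall>x\<in>set xs. odd x"
  shows "card (fst (tiling_pair xs)) = even_index_prod xs"
    and "card (snd (tiling_pair xs)) = odd_index_prod xs"
proof -
  have "card (fst (tiling_pair xs)) = even_index_prod xs \<and>
        card (snd (tiling_pair xs)) = odd_index_prod xs"
    using assms
  proof (induction xs)
    case Nil
    show ?case by (simp add: even_index_prod_def odd_index_prod_def)
  next
    case (Cons f xs)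
    have f: "f = 2 * (f div 2) + 1"
      using Cons.prems by simp
    have "inj_on (\<lambda>(k, a). k + int f * a) (sym_interval (f div 2) \<times> snd (tiling_pair xs))"
      using mixed_radix_eq_iff[OF _ _ f] by (auto simp: inj_on_def)
    moreover have "inj_on ((*) (int f)) (fst (tiling_pair xs))"
      using f by (auto simp: inj_on_def)
    ultimately show ?case
      using Cons f
      by (simp add: card_image card_cartesian_product even_index_prod_Cons odd_index_prod_Cons)
  qed
  then show "card (fst (tiling_pair xs)) = even_index_prod xs"
    and "card (snd (tiling_pair xs)) = odd_index_prod xs" by auto
qed

section \<open>Recovering the sequence from its tiling\<close>

lemma one_notin_snd_tiling_pair:
  assumes "\<forall>x\<in>set xs. x > 1"
  shows "1 \<notin> snd (tiling_pair xs)"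
proof (cases xs)
  case (Cons f ys)
  \<comment> \<open>The elements of the second component are multiples of \<open>f > 1\<close>. The
    equation arises with 1 on the left, hence the reversal.\<close>
  then show ?thesis
    using assms by (auto simp: zmult_eq_1_iff dest!: sym[of 1])
qed simp

lemma zero_in_tiling_pair: "0 \<in> fst (tiling_pair xs)" "0 \<in> snd (tiling_pair xs)"
proof -
  have "0 \<in> fst (tiling_pair xs) \<and> 0 \<in> snd (tiling_pair xs)"
    by (induction xs) (force simp: sym_interval_def image_iff)+
  then show "0 \<in> fst (tiling_pair xs)" "0 \<in> snd (tiling_pair xs)" by auto
qed

text \<open>The first entry \<open>f\<close> of the list can be read off the first component, because
  \<open>1, \<dots>, f div 2\<close> belong to it whereas \<open>f div 2 + 1\<close> does not.\<close>

lemma in_fst_tiling_pair_Cons: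
  assumes "int k \<le> int (f div 2)"
  shows "int k \<in> fst (tiling_pair (f # xs))"
proof -
  have "int k = (\<lambda>(k, a). k + int f * a) (int k, 0)" by simp
  moreover have "(int k, 0) \<in> sym_interval (f div 2) \<times> snd (tiling_pair xs)"
    using assms zero_in_tiling_pair by (auto simp: sym_interval_def)
  ultimately have "int k \<in> (\<lambda>(k, a). k + int f * a) `
      (sym_interval (f div 2) \<times> snd (tiling_pair xs))"
    by (rule image_eqI)
  then show ?thesis by simp
qed

lemma notin_fst_tiling_pair_Cons:
  assumes "\<forall>x\<in>set (f # xs). odd x \<and> x > 1"
  shows "int (f div 2 + 1) \<notin> fst (tiling_pair (f # xs))"
proof
  define h where "h = f div 2"
  have f: "f = 2 * h + 1"
    using assms by (simp add: h_def)
  assume "int (f div 2 + 1) \<in> fst (tiling_pair (f # xs))"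
  then obtain k a where ka: "k \<in> sym_interval h" "a \<in> snd (tiling_pair xs)"
    "int (h + 1) = k + int f * a"
    by (auto simp: h_def)
  \<comment> \<open>The balanced expansion of h + 1 has digit -h and carry 1, so 1 would lie in the
    second component of the tail.\<close>
  have "- int h + int f * 1 = k + int f * a"
    using ka f by simp
  then have "a = 1"
    using mixed_radix_eq_iff[OF _ ka(1) f, of "- int h" 1 a] by (simp add: sym_interval_def)
  with ka(2) one_notin_snd_tiling_pair[of xs] assms show False
    by auto
qed

lemma one_in_fst_tiling_pair_Cons:
  assumes "f > 1"
  shows "1 \<in> fst (tiling_pair (f # xs))"
proof -
  have "int 1 \<in> fst (tiling_pair (f # xs))"
    using assms by (intro in_fst_tiling_pair_Cons) auto
  then show ?thesis by (simp only: of_nat_1)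
qed

lemma tiling_pair_eq_zero_iff:
  assumes "\<forall>x\<in>set xs. x > 1"
  shows "tiling_pair xs = ({0}, {0}) \<longleftrightarrow> xs = []"
proof
  assume eq: "tiling_pair xs = ({0}, {0})"
  show "xs = []"
  proof (cases xs)
    case (Cons f ys)
    then have "1 \<in> fst (tiling_pair xs)"
      using one_in_fst_tiling_pair_Cons assms by (simp del: tiling_pair.simps)
    then show ?thesis by (simp add: eq)
  qed
qed simp

text \<open>The head is found from the run 1, ..., f div 2 in the first component. The second
  component of the tail then consists of the \<open>a\<close> with \<open>f * a\<close> in the first
  component, and its first component is the second one divided by \<open>f\<close>.\<close>

lemma tiling_pair_eqD:
  assumes "\<forall>x\<in>set xs. odd x \<and> x > 1" "\<forall>x\<in>set ys. odd x \<and> x > 1"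
    and "tiling_pair xs = tiling_pair ys"
  shows "xs = ys"
  using assms
proof (induction xs arbitrary: ys)
  case Nil
  then show ?case
    using tiling_pair_eq_zero_iff[of ys] by (simp del: tiling_pair.simps(2))
next
  case (Cons f xs)
  have "ys \<noteq> []"
  proof
    assume "ys = []"
    then have "tiling_pair (f # xs) = ({0}, {0})"
      using Cons.prems(3) by (simp only: tiling_pair.simps(1))
    then show False
      using tiling_pair_eq_zero_iff[of "f # xs"] Cons.prems(1) by blast
  qed
  then obtain g zs where ys: "ys = g # zs"
    by (cases ys) auto
  have *: "f div 2 \<le> g div 2"
    if "\<forall>x\<in>set (g # zs). odd x \<and> x > 1"
       "tiling_pair (f # xs) = tiling_pair (g # zs)" for f g xs zs
  proof (rule ccontr)
    assume "\<not> f div 2 \<le> g div 2"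
    then have "int (g div 2 + 1) \<in> fst (tiling_pair (f # xs))"
      by (intro in_fst_tiling_pair_Cons) simp
    with notin_fst_tiling_pair_Cons[OF that(1)] that(2) show False
      by simp
  qed
  have "f div 2 = g div 2"
    using *[of g zs f xs] *[of f xs g zs] Cons.prems ys by (intro antisym) auto
  moreover have "odd f" "odd g"
    using Cons.prems ys by auto
  ultimately have fg: "f = g"
    by (metis odd_two_times_div_two_succ)
  define h where "h = f div 2"
  have f: "f = 2 * h + 1"
    using \<open>odd f\<close> by (simp add: h_def)
  have eq: "tiling_pair (f # xs) = tiling_pair (f # zs)"
    using Cons.prems ys fg by simp
  have sub: "snd (tiling_pair us) \<subseteq> snd (tiling_pair vs)"
    if "tiling_pair (f # us) = tiling_pair (f # vs)" for us vs
  proof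
    fix a assume "a \<in> snd (tiling_pair us)"
    then have "0 + int f * a \<in> fst (tiling_pair (f # us))"
      by (force simp: sym_interval_def)
    then have "0 + int f * a \<in> fst (tiling_pair (f # vs))"
      using that by metis
    then obtain k b where kb: "k \<in> sym_interval h" "b \<in> snd (tiling_pair vs)"
      "0 + int f * a = k + int f * b"
      by (auto simp: h_def)
    then have "a = b"
      using mixed_radix_eq_iff[OF _ kb(1) f, of 0] by (simp add: sym_interval_def)
    with kb show "a \<in> snd (tiling_pair vs)" by simp
  qed
  have "snd (tiling_pair xs) = snd (tiling_pair zs)"
    using sub[OF eq] sub[OF eq[symmetric]] by blast
  moreover have "inj ((*) (int f))"
    using f by (auto simp: inj_on_def)
  then have "fst (tiling_pair xs) = fst (tiling_pair zs)"
    using eq by (simp add: inj_image_eq_iff)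
  ultimately have "tiling_pair xs = tiling_pair zs"
    by (simp add: prod_eq_iff)
  then show ?case
    using Cons.IH[of zs] Cons.prems ys fg by simp
qed

subsection \<open>Tilings from factorization sequences\<close>

lemma proj_factorization_seqsD:
  assumes "xs \<in> proj_factorization_seqs m n"
  shows "\<forall>x\<in>set xs. x > 1" "even_index_prod xs = m" "odd_index_prod xs = n"
  using assms
  by (auto simp: proj_factorization_seqs_def even_index_prod_def odd_index_prod_def)

lemma proj_factorization_seqs_odd:
  assumes "xs \<in> proj_factorization_seqs m n" "odd m" "odd n"
  shows "\<forall>x\<in>set xs. odd x \<and> x > 1"
proof -
  have "odd (prod_list xs)"
    using proj_factorization_seqsD[OF assms(1)] even_index_prod_mult_odd_index_prod[of xs] assms(2,3)
    by (metis even_mult_iff)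
  then have "\<forall>x\<in>set xs. odd x"
    by (induction xs) auto
  then show ?thesis
    using proj_factorization_seqsD[OF assms(1)] by blast
qed

definition sized_tilings :: "nat \<Rightarrow> nat \<Rightarrow> (int set \<times> int set) set" where
  "sized_tilings m n =
     {(A, B). symmetric_tiling (m * n div 2) A B \<and> card A = m \<and> card B = n}"

text \<open>Widening the interval adds two endpoints of equal parity, so the sum changes by -2 and 2
  alternately and flips between 1 and -1.\<close>

lemma sum_minus_one_power_sym_interval:
  "(\<Sum>k\<in>sym_interval h. if even k then 1 else - 1 :: int) = (if even h then 1 else - 1)"
proof (induction h)
  case (Suc h)
  have "sym_interval (Suc h) = insert (int (Suc h)) (insert (- int (Suc h)) (sym_interval h))"
    by (auto simp: sym_interval_def)
  then show ?case
    using Suc by (simp add: sym_interval_def)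
qed (simp add: sym_interval_def)

text \<open>Summing \<open>(-1) ^ (a + b)\<close> over a symmetric tiling shows that the signed count of \<open>A\<close> is a
  unit of the integers, which determines how many positive elements of \<open>A\<close> are even.\<close>

lemma symmetric_tiling_parity:
  assumes t: "symmetric_tiling H A B" and fin: "finite A" and card: "card A = 2 * p + 1"
  shows "0 \<in> A" and "card {a\<in>A. a > 0 \<and> even a} = p div 2"
    and "card {a\<in>A. a > 0 \<and> odd a} = p - p div 2"
proof -
  let ?s = "\<lambda>k::int. if even k then 1 else - 1 :: int"
  define E where "E = {a\<in>A. a > 0 \<and> even a}"
  define D where "D = {a\<in>A. a > 0 \<and> odd a}"
  have sym: "- a \<in> A" if "a \<in> A" for a
    using t that by (simp add: symmetric_tiling_def)
  have finED: "finite E" "finite D"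
    using fin by (auto simp: E_def D_def)
  \<comment> \<open>Negation pairs the nonzero elements, so the odd size forces 0 into
    \<open>A\<close> and the positive elements decide everything.\<close>
  have A: "A - {0} = (E \<union> D) \<union> uminus ` (E \<union> D)" (is "_ = ?R")
  proof (intro equalityI subsetI)
    fix x assume x: "x \<in> A - {0}"
    show "x \<in> ?R"
    proof (cases "x > 0")
      case True
      with x show ?thesis by (auto simp: E_def D_def)
    next
      case False
      with x have "- x \<in> E \<union> D" using sym[of x] by (auto simp: E_def D_def)
      then show ?thesis by (metis UnI2 imageI minus_minus)
    qed
  qed (use sym in \<open>auto simp: E_def D_def\<close>)
  have disj: "(E \<union> D) \<inter> uminus ` (E \<union> D) = {}" "E \<inter> D = {}"
    by (auto simp: E_def D_def)
  have cardA: "card (A - {0}) = 2 * (card E + card D)"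
    unfolding A using disj finED by (simp add: card_Un_disjoint card_image)
  show zero: "0 \<in> A"
  proof (rule ccontr)
    assume "0 \<notin> A"
    then have "2 * p + 1 = 2 * (card E + card D)"
      using cardA card by simp
    then show False by presburger
  qed
  then have p: "p = card E + card D"
    using cardA card fin by simp
  have "sum ?s (E \<union> D) = int (card E) - int (card D)"
    using disj finED by (subst sum.union_disjoint) (auto simp: E_def D_def)
  moreover have "sum ?s (uminus ` (E \<union> D)) = sum ?s (E \<union> D)"
    by (subst sum.reindex) auto
  ultimately have "sum ?s (A - {0}) = 2 * (int (card E) - int (card D))"
    unfolding A using disj finED by (subst sum.union_disjoint) auto
  then have sumA: "sum ?s A = 1 + 2 * (int (card E) - int (card D))"
    using sum.remove[OF fin zero, of ?s] by simp
  have "sum ?s A * sum ?s B = (\<Sum>(a, b)\<in>A \<times> B. ?s a * ?s b)"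
    by (simp add: sum_product sum.cartesian_product)
  also have "\<dots> = (\<Sum>x\<in>A \<times> B. ?s ((\<lambda>(a, b). a + b) x))"
    by (intro sum.cong) auto
  also have "\<dots> = sum ?s (sym_interval H)"
    using t unfolding symmetric_tiling_def
    by (intro sum.reindex_bij_betw[where g = ?s]) simp
  finally have "\<bar>sum ?s A * sum ?s B\<bar> = 1"
    by (simp add: sum_minus_one_power_sym_interval)
  then have "\<bar>sum ?s A\<bar> = 1"
    by (metis abs_mult abs_zmult_eq_1 abs_abs)
  then have "\<bar>1 + 2 * (int (card E) - int (card D))\<bar> = 1"
    unfolding sumA .
  \<comment> \<open>The difference of the even and odd counts is 0 or -1; as the counts add up to
    \<open>p\<close>, both are determined.\<close>
  then have "card D = card E \<or> card D = card E + 1"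
    by presburger
  with p have "card E = p div 2 \<and> card D = p - p div 2"
    by auto
  then show "card {a\<in>A. a > 0 \<and> even a} = p div 2"
    and "card {a\<in>A. a > 0 \<and> odd a} = p - p div 2"
    by (auto simp: E_def D_def)
qed

text \<open>Sequences for (m, n) give pairs whose first set contains 1; sequences for (n, m), after
  a swap, give pairs whose first set does not. So the two families are disjoint, and each is counted
  without repetition.\<close>

lemma tau_le_card_sized_tilings:
  assumes "odd m" "odd n" "m > 1" "n > 1"
  shows "finite (sized_tilings m n)" and "tau m n + tau n m \<le> card (sized_tilings m n)"
proof -
  let ?T = "tiling_pair ` proj_factorization_seqs m n"
  let ?U = "(prod.swap \<circ> tiling_pair) ` proj_factorization_seqs n m"
  \<comment> \<open>Both sets contain 0, so each lies inside the set of sums; this bounds the number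
    of tilings.\<close>
  have "A \<subseteq> sym_interval (m * n div 2) \<and> B \<subseteq> sym_interval (m * n div 2)"
    if AB: "(A, B) \<in> sized_tilings m n" for A B
  proof -
    have t: "symmetric_tiling (m * n div 2) A B"
      and "finite A" "card A = 2 * (m div 2) + 1" "finite B" "card B = 2 * (n div 2) + 1"
      using AB assms by (auto simp: sized_tilings_def intro!: card_ge_0_finite)
    then have "0 \<in> A" "0 \<in> B"
      using symmetric_tiling_parity(1) symmetric_tiling_commute by blast+
    moreover have "a + b \<in> sym_interval (m * n div 2)" if "a \<in> A" "b \<in> B" for a b
      using t that by (force simp: symmetric_tiling_def bij_betw_def)
    ultimately show ?thesis by force
  qed
  then have "sized_tilings m n \<subseteq>
      Pow (sym_interval (m * n div 2)) \<times> Pow (sym_interval (m * n div 2))"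
    by auto
  then show fin: "finite (sized_tilings m n)"
    by (rule finite_subset) simp
  have tiling: "symmetric_tiling (m * n div 2) (fst (tiling_pair xs)) (snd (tiling_pair xs)) \<and>
      card (fst (tiling_pair xs)) = m \<and> card (snd (tiling_pair xs)) = n"
    if xs: "xs \<in> proj_factorization_seqs m n" and "odd m" "odd n" for xs m n
  proof -
    have "\<forall>x\<in>set xs. odd x"
      using proj_factorization_seqs_odd[OF that] by blast
    then show ?thesis
      using symmetric_tiling_tiling_pair[of xs] card_tiling_pair[of xs]
        even_index_prod_mult_odd_index_prod[of xs] proj_factorization_seqsD[OF xs]
      by simp
  qed
  have sub: "?T \<union> ?U \<subseteq> sized_tilings m n"
  proof
    fix t assume "t \<in> ?T \<union> ?U"
    then show "t \<in> sized_tilings m n"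
    proof
      assume "t \<in> ?T"
      then show ?thesis
        using tiling[OF _ assms(1,2)] by (force simp: sized_tilings_def)
    next
      assume "t \<in> ?U"
      then show ?thesis
        using tiling[OF _ assms(2,1)] symmetric_tiling_commute
        by (force simp: sized_tilings_def mult.commute)
    qed
  qed
  have inj: "inj_on tiling_pair (proj_factorization_seqs m n)" if "odd m" "odd n" for m n
    using that by (blast intro: inj_onI tiling_pair_eqD dest: proj_factorization_seqs_odd)
  have "?T \<inter> ?U = {}"
  proof -
    have False if xs: "xs \<in> proj_factorization_seqs m n" and ys: "ys \<in> proj_factorization_seqs n m"
      and eq: "tiling_pair xs = prod.swap (tiling_pair ys)" for xs ys
    proof -
      have "xs \<noteq> []"
        using xs by (auto simp: proj_factorization_seqs_def)
      then obtain f zs where "xs = f # zs"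
        by (cases xs) auto
      then have "1 \<in> fst (tiling_pair xs)"
        using proj_factorization_seqsD(1)[OF xs] one_in_fst_tiling_pair_Cons
        by (simp del: tiling_pair.simps)
      then show False
        using one_notin_snd_tiling_pair[OF proj_factorization_seqsD(1)[OF ys]] eq by simp
    qed
    then show ?thesis by fastforce
  qed
  moreover have "card ?T = tau m n"
    using inj[OF assms(1,2)] by (simp add: card_image tau_def)
  moreover have "card ?U = tau n m"
    unfolding tau_def by (intro card_image comp_inj_on inj[OF assms(2,1)]) simp
  moreover have "finite ?T" "finite ?U"
    using finite_subset[OF sub fin] by auto
  ultimately have "card (?T \<union> ?U) = tau m n + tau n m"
    by (simp add: card_Un_disjoint)
  then show "tau m n + tau n m \<le> card (sized_tilings m n)"
    using card_mono[OF fin sub] by simp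
qed

subsection \<open>Odd parity-preserving arrangements\<close>

text \<open>Forcing the value 0 off the interval makes a function determined by its values on it, so
  that \<open>card\<close> counts arrangements.\<close>

definition odd_arrangements :: "nat \<Rightarrow> int set \<Rightarrow> (int \<Rightarrow> int) set" where
  "odd_arrangements p A =
     {P. (\<forall>u. P (- u) = - P u) \<and> (\<forall>u. u \<notin> sym_interval p \<longrightarrow> P u = 0) \<and>
         bij_betw P (sym_interval p) A \<and> (\<forall>u\<in>sym_interval p. even (P u) \<longleftrightarrow> even u)}"

lemma finite_odd_arrangements:
  assumes "finite A"
  shows "finite (odd_arrangements p A)"
proof (rule finite_subset)
  show "odd_arrangements p A \<subseteq>
      {P. \<forall>u. (u \<in> sym_interval p \<longrightarrow> P u \<in> A) \<and> (u \<notin> sym_interval p \<longrightarrow> P u = 0)}"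
    by (auto simp: odd_arrangements_def bij_betw_def)
  show "finite {P. \<forall>u. (u \<in> sym_interval p \<longrightarrow> P u \<in> A) \<and> (u \<notin> sym_interval p \<longrightarrow> P u = 0)}"
    by (intro finite_set_of_finite_funs assms finite_sym_interval)
qed

text \<open>An odd function is fixed by its values at positive offsets: a positive \<open>g\<close>
  supplies the absolute values there and \<open>T\<close> the places of minus signs, while
  \<open>sgn u\<close> supplies oddness and the value 0 at 0.\<close>

definition signed_extension :: "nat \<Rightarrow> (int \<Rightarrow> int) \<Rightarrow> int set \<Rightarrow> int \<Rightarrow> int" where
  "signed_extension p g T u =
     (if u \<in> sym_interval p then sgn u * (if \<bar>u\<bar> \<in> T then - g \<bar>u\<bar> else g \<bar>u\<bar>) else 0)"

text \<open>Signs do not affect parity. The absolute value of the image determines the offset up to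
  sign, and oddness separates \<open>u\<close> from \<open>- u\<close>; surjectivity follows by
  counting.\<close>

lemma signed_extension_in_odd_arrangements:
  assumes g: "bij_betw g {1..int p} {a\<in>A. a > 0}" "\<forall>u\<in>{1..int p}. even (g u) \<longleftrightarrow> even u"
    and A: "finite A" "0 \<in> A" "\<forall>a\<in>A. - a \<in> A" "card A = 2 * p + 1"
  shows "signed_extension p g T \<in> odd_arrangements p A"
proof -
  let ?P = "signed_extension p g T"
  have gA: "g \<bar>u\<bar> \<in> A \<and> g \<bar>u\<bar> > 0" if "u \<in> sym_interval p" "u \<noteq> 0" for u
  proof -
    have "\<bar>u\<bar> \<in> {1..int p}"
      using that by (auto simp: sym_interval_def)
    then show ?thesis
      using g(1) by (auto simp: bij_betw_def)
  qed
  have abs: "\<bar>?P u\<bar> = g \<bar>u\<bar>" if "u \<in> sym_interval p" "u \<noteq> 0" for u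
    using gA[OF that] that by (auto simp: signed_extension_def abs_mult)
  have zero: "?P 0 = 0"
    by (simp add: signed_extension_def)
  have neg: "?P (- u) = - ?P u" for u
    by (auto simp: signed_extension_def sym_interval_def sgn_minus)
  have parity: "even (?P u) \<longleftrightarrow> even u" if "u \<in> sym_interval p" for u
  proof (cases "u = 0")
    case False
    then have "\<bar>u\<bar> \<in> {1..int p}"
      using that by (auto simp: sym_interval_def)
    then have "even (g \<bar>u\<bar>) \<longleftrightarrow> even \<bar>u\<bar>"
      using g(2) by blast
    then show ?thesis
      using abs[OF that False] by (metis even_abs_add_iff add.right_neutral)
  qed (simp add: zero)
  have "inj_on ?P (sym_interval p)"
  proof (rule inj_onI)
    fix u v assume u: "u \<in> sym_interval p" and v: "v \<in> sym_interval p" and eq: "?P u = ?P v"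
    have nz: "?P w = 0 \<longleftrightarrow> w = 0" if "w \<in> sym_interval p" for w
      using abs[OF that] gA[OF that] zero by force
    show "u = v"
    proof (cases "u = 0 \<or> v = 0")
      case True
      then show ?thesis using nz[OF u] nz[OF v] eq zero by auto
    next
      case False
      then have "g \<bar>u\<bar> = g \<bar>v\<bar>"
        using abs[OF u] abs[OF v] eq by simp
      moreover have "\<bar>u\<bar> \<in> {1..int p}" "\<bar>v\<bar> \<in> {1..int p}"
        using u v False by (auto simp: sym_interval_def)
      ultimately have "\<bar>u\<bar> = \<bar>v\<bar>"
        using g(1) by (auto simp: bij_betw_def dest: inj_onD)
      moreover have "u \<noteq> - v"
        using neg[of v] eq nz[OF v] False by auto
      ultimately show ?thesis by linarith
    qed
  qed
  moreover have "?P ` sym_interval p \<subseteq> A"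
  proof clarify
    fix u assume u: "u \<in> sym_interval p"
    show "?P u \<in> A"
    proof (cases "u = 0")
      case False
      then have "\<bar>?P u\<bar> \<in> A"
        using abs[OF u] gA[OF u] by simp
      then show ?thesis
        using A(3) by (metis abs_if minus_minus)
    qed (simp add: zero A)
  qed
  ultimately have "bij_betw ?P (sym_interval p) A"
    unfolding bij_betw_def using A(1,4) by (simp add: card_subset_eq card_image)
  then show ?thesis
    using neg parity by (auto simp: odd_arrangements_def signed_extension_def)
qed

text \<open>Positivity of \<open>g\<close> and \<open>g'\<close> lets absolute value and sign be
  read off separately at each positive offset.\<close>

lemma signed_extension_eqD:
  assumes "signed_extension p g T = signed_extension p g' T'"
    and pos: "\<forall>u\<in>{1..int p}. g u > 0" "\<forall>u\<in>{1..int p}. g' u > 0"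
    and T: "T \<subseteq> {1..int p}" "T' \<subseteq> {1..int p}"
  shows "T = T'" and "\<And>u. u \<in> {1..int p} \<Longrightarrow> g u = g' u"
proof -
  have *: "g u = g' u \<and> (u \<in> T \<longleftrightarrow> u \<in> T')" if u: "u \<in> {1..int p}" for u
  proof -
    have "(if u \<in> T then - g u else g u) = (if u \<in> T' then - g' u else g' u)"
      using fun_cong[OF assms(1), of u] u by (auto simp: signed_extension_def sym_interval_def)
    then show ?thesis
      using bspec[OF pos(1) u] bspec[OF pos(2) u] by (auto split: if_splits)
  qed
  then show "T = T'" using T by blast
  show "g u = g' u" if "u \<in> {1..int p}" for u using * that by blast
qed

lemma finite_Collect_interval [simp]: "finite {u::int. a \<le> u \<and> u \<le> b \<and> Q u}"
  by (rule finite_subset[of _ "{a..b}"]) auto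

lemma card_parity_classes:
  "card {u\<in>{1..int p}. even u} = p div 2" "card {u\<in>{1..int p}. odd u} = p - p div 2"
proof -
  have "card {u\<in>{1..int p}. even u} = p div 2 \<and> card {u\<in>{1..int p}. odd u} = p - p div 2"
  proof (induction p)
    case (Suc p)
    have "{u\<in>{1..int (Suc p)}. Q u} =
        (if Q (int (Suc p)) then insert (int (Suc p)) {u\<in>{1..int p}. Q u} else {u\<in>{1..int p}. Q u})"
      for Q
    proof -
      have "{1..int (Suc p)} = insert (int (Suc p)) {1..int p}" by auto
      then show ?thesis by auto
    qed
    from this[of even] this[of odd] show ?case
      using Suc by (cases "even p") (auto elim!: evenE oddE)
  qed simp
  then show "card {u\<in>{1..int p}. even u} = p div 2" "card {u\<in>{1..int p}. odd u} = p - p div 2"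
    by auto
qed

text \<open>The parity balance yields a parity-preserving bijection from \<open>{1..int p}\<close>
  onto the positive elements of \<open>A\<close>. Precomposing it with permutations of the even and
  of the odd offsets gives the factorials, and free signs give \<open>2 ^ p\<close>.\<close>

lemma card_odd_arrangements_ge:
  assumes t: "symmetric_tiling H A B" and fin: "finite A" and card: "card A = 2 * p + 1"
  shows "2 ^ p * (fact (p div 2) * fact (p - p div 2)) \<le> card (odd_arrangements p A)"
proof -
  let ?E = "{u\<in>{1..int p}. even u}" and ?D = "{u\<in>{1..int p}. odd u}"
  note par = symmetric_tiling_parity[OF assms]
  obtain e where e: "bij_betw e ?E {a\<in>A. a > 0 \<and> even a}"
    using finite_same_card_bij[of ?E "{a\<in>A. a > 0 \<and> even a}"] fin par(2) card_parity_classes(1)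
    by auto
  obtain d where d: "bij_betw d ?D {a\<in>A. a > 0 \<and> odd a}"
    using finite_same_card_bij[of ?D "{a\<in>A. a > 0 \<and> odd a}"] fin par(3) card_parity_classes(2)
    by auto
  define h where "h u = (if even u then e u else d u)" for u
  have "bij_betw h (?E \<union> ?D) ({a\<in>A. a > 0 \<and> even a} \<union> {a\<in>A. a > 0 \<and> odd a})"
  proof (rule bij_betw_combine)
    show "bij_betw h ?E {a\<in>A. a > 0 \<and> even a}"
      using e by (rule bij_betw_cong[THEN iffD1, rotated]) (auto simp: h_def)
    show "bij_betw h ?D {a\<in>A. a > 0 \<and> odd a}"
      using d by (rule bij_betw_cong[THEN iffD1, rotated]) (auto simp: h_def)
  qed auto
  moreover have "?E \<union> ?D = {1..int p}"
    "{a\<in>A. a > 0 \<and> even a} \<union> {a\<in>A. a > 0 \<and> odd a} = {a\<in>A. a > 0}"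
    by auto
  ultimately have h: "bij_betw h {1..int p} {a\<in>A. a > 0}"
    by simp
  have h_even: "even (h u) \<longleftrightarrow> even u" if "u \<in> {1..int p}" for u
    using that e d by (auto simp: h_def bij_betw_def)
  let ?S = "{\<sigma>. \<sigma> permutes ?E}" and ?R = "{\<rho>. \<rho> permutes ?D}" and ?T = "Pow {1..int p}"
  let ?f = "\<lambda>((\<sigma>, \<rho>), T). signed_extension p (h \<circ> (\<sigma> \<circ> \<rho>)) T"
  \<comment> \<open>The supports are disjoint, so the composition acts as one permutation on even
    offsets and as the other on odd ones.\<close>
  have perm: "(\<sigma> \<circ> \<rho>) permutes {1..int p} \<and> (\<forall>u\<in>?E. (\<sigma> \<circ> \<rho>) u = \<sigma> u) \<and> (\<forall>u\<in>?D. (\<sigma> \<circ> \<rho>) u = \<rho> u) \<and>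
      (\<forall>u\<in>{1..int p}. even ((\<sigma> \<circ> \<rho>) u) \<longleftrightarrow> even u)"
    if s: "\<sigma> permutes ?E" and r: "\<rho> permutes ?D" for \<sigma> \<rho>
  proof (intro conjI ballI)
    show "(\<sigma> \<circ> \<rho>) permutes {1..int p}"
      using s r by (intro permutes_compose) (auto elim: permutes_subset)
    show E: "(\<sigma> \<circ> \<rho>) u = \<sigma> u" if "u \<in> ?E" for u
      using permutes_not_in[OF r, of u] that by simp
    have rD: "\<rho> u \<in> ?D" if "u \<in> ?D" for u
      using permutes_in_image[OF r] that by blast
    show D: "(\<sigma> \<circ> \<rho>) u = \<rho> u" if "u \<in> ?D" for u
      using permutes_not_in[OF s, of "\<rho> u"] rD[OF that] by simp
    fix u assume "u \<in> {1..int p}"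
    then consider "u \<in> ?E" | "u \<in> ?D" by blast
    then show "even ((\<sigma> \<circ> \<rho>) u) \<longleftrightarrow> even u"
    proof cases
      case 1
      then have "\<sigma> u \<in> ?E"
        using permutes_in_image[OF s] by blast
      then show ?thesis unfolding E[OF 1] using 1 by simp
    next
      case 2
      then show ?thesis unfolding D[OF 2] using rD[OF 2] by simp
    qed
  qed
  have g: "bij_betw (h \<circ> (\<sigma> \<circ> \<rho>)) {1..int p} {a\<in>A. a > 0}"
    if "\<sigma> permutes ?E" "\<rho> permutes ?D" for \<sigma> \<rho>
    using perm[OF that] h by (blast intro: bij_betw_trans permutes_imp_bij)
  have "inj_on ?f ((?S \<times> ?R) \<times> ?T)"
  proof (rule inj_onI)
    fix x y assume xy: "x \<in> (?S \<times> ?R) \<times> ?T" "y \<in> (?S \<times> ?R) \<times> ?T" "?f x = ?f y"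
    obtain \<sigma> \<rho> T \<sigma>' \<rho>' T' where x: "x = ((\<sigma>, \<rho>), T)" and y: "y = ((\<sigma>', \<rho>'), T')"
      by (metis surj_pair)
    have s: "\<sigma> permutes ?E" "\<sigma>' permutes ?E" and r: "\<rho> permutes ?D" "\<rho>' permutes ?D"
      and T: "T \<subseteq> {1..int p}" "T' \<subseteq> {1..int p}"
      and eq: "signed_extension p (h \<circ> (\<sigma> \<circ> \<rho>)) T = signed_extension p (h \<circ> (\<sigma>' \<circ> \<rho>')) T'"
      using xy unfolding x y prod.case by blast+
    have pos: "\<forall>u\<in>{1..int p}. (h \<circ> (\<sigma> \<circ> \<rho>)) u > 0" "\<forall>u\<in>{1..int p}. (h \<circ> (\<sigma>' \<circ> \<rho>')) u > 0"
      using bij_betwE[OF g[OF s(1) r(1)]] bij_betwE[OF g[OF s(2) r(2)]] by blast+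
    note D = signed_extension_eqD[OF eq pos T]
    have sr: "(\<sigma> \<circ> \<rho>) u = (\<sigma>' \<circ> \<rho>') u" if u: "u \<in> {1..int p}" for u
    proof (rule inj_onD[of h "{1..int p}"])
      show "inj_on h {1..int p}" using h by (simp add: bij_betw_def)
      show "h ((\<sigma> \<circ> \<rho>) u) = h ((\<sigma>' \<circ> \<rho>') u)" using D(2)[OF u] by simp
      show "(\<sigma> \<circ> \<rho>) u \<in> {1..int p}" "(\<sigma>' \<circ> \<rho>') u \<in> {1..int p}"
        using perm[OF s(1) r(1), THEN conjunct1, THEN permutes_in_image, of u]
          perm[OF s(2) r(2), THEN conjunct1, THEN permutes_in_image, of u] u by auto
    qed
    have "\<sigma> u = \<sigma>' u" for u
    proof (cases "u \<in> ?E")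
      case True
      then show ?thesis using sr[of u] perm[OF s(1) r(1)] perm[OF s(2) r(2)] by auto
    next
      case False
      then show ?thesis using permutes_not_in[OF s(1) False] permutes_not_in[OF s(2) False] by simp
    qed
    moreover have "\<rho> u = \<rho>' u" for u
    proof (cases "u \<in> ?D")
      case True
      then show ?thesis using sr[of u] perm[OF s(1) r(1)] perm[OF s(2) r(2)] by auto
    next
      case False
      then show ?thesis using permutes_not_in[OF r(1) False] permutes_not_in[OF r(2) False] by simp
    qed
    ultimately show "x = y"
      unfolding x y using D(1) by auto
  qed
  moreover have "?f ` ((?S \<times> ?R) \<times> ?T) \<subseteq> odd_arrangements p A"
  proof
    fix x assume "x \<in> ?f ` ((?S \<times> ?R) \<times> ?T)"
    then obtain y where y: "x = ?f y" "y \<in> (?S \<times> ?R) \<times> ?T"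
      by (rule imageE)
    obtain \<sigma> \<rho> T where y': "y = ((\<sigma>, \<rho>), T)"
      by (metis surj_pair)
    have s: "\<sigma> permutes ?E" and r: "\<rho> permutes ?D"
      and x: "x = signed_extension p (h \<circ> (\<sigma> \<circ> \<rho>)) T"
      using y unfolding y' prod.case by blast+
    have ev: "even ((h \<circ> (\<sigma> \<circ> \<rho>)) u) \<longleftrightarrow> even u" if "u \<in> {1..int p}" for u
    proof -
      have "(\<sigma> \<circ> \<rho>) u \<in> {1..int p}"
        using perm[OF s r, THEN conjunct1, THEN permutes_in_image, of u] that by blast
      then show ?thesis using perm[OF s r] h_even that by simp
    qed
    show "x \<in> odd_arrangements p A"
      unfolding x using t by (intro signed_extension_in_odd_arrangements g[OF s r] ballI ev fin par(1) card)
        (auto simp: symmetric_tiling_def)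
  qed
  ultimately have "card ((?S \<times> ?R) \<times> ?T) \<le> card (odd_arrangements p A)"
    by (rule card_inj_on_le) (rule finite_odd_arrangements[OF fin])
  moreover have "card ((?S \<times> ?R) \<times> ?T) = 2 ^ p * (fact (p div 2) * fact (p - p div 2))"
    using card_permutations[OF card_parity_classes(1)] card_permutations[OF card_parity_classes(2)]
    by (simp add: card_cartesian_product card_Pow)
  ultimately show ?thesis by simp
qed

text \<open>There are \<open>m div 2\<close> positive offsets; the even and odd ones number k and k
  if m = 4k + 1, and k and k + 1 if m = 4k + 3.\<close>

lemma beta_altdef:
  assumes "odd m"
  shows "beta m = fact (m div 2 div 2) * fact (m div 2 - m div 2 div 2)"
proof -
  have "m mod 4 = 1 \<or> m mod 4 = 3"
    using assms by presburger
  then obtain k where "m = 4 * k + 1 \<or> m = 4 * k + 3"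
    by (metis mult_div_mod_eq)
  then show ?thesis
  proof
    assume "m = 4 * k + 1"
    then have "m mod 4 = 1" "(m - 1) div 4 = k" "m div 2 = 2 * k" by auto
    then show ?thesis by (simp add: beta_def power2_eq_square)
  next
    assume "m = 4 * k + 3"
    then have "m mod 4 = 3" "(m - 3) div 4 = k" "(m + 1) div 4 = k + 1" "m div 2 = 2 * k + 1"
      by auto
    then show ?thesis by (simp add: beta_def)
  qed
qed

subsection \<open>Labelings from arrangements\<close>

definition zigzag :: "nat \<Rightarrow> int \<Rightarrow> nat" where
  "zigzag N c = nat (if even c then c div 2 + 1 else int N - c div 2)"

text \<open>Doubling removes the halving, and the range keeps the argument of \<open>nat\<close>
  nonnegative, so later steps are linear arithmetic.\<close>

lemma int_zigzag:
  assumes "c \<in> {0..<int N}"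
  shows "2 * int (zigzag N c) = (if even c then c + 2 else 2 * int N - c + 1)"
  using assms by (auto simp: zigzag_def elim!: evenE oddE)

text \<open>An even c and an odd d with equal labels would satisfy c + d = 2N - 1, but c + d is at
  most 2N - 2; surjectivity follows by counting.\<close>

lemma bij_betw_zigzag: "bij_betw (zigzag N) {0..<int N} {1..N}"
proof -
  have inj: "inj_on (zigzag N) {0..<int N}"
  proof (rule inj_onI)
    fix c d assume c: "c \<in> {0..<int N}" and d: "d \<in> {0..<int N}" and "zigzag N c = zigzag N d"
    then have "(if even c then c + 2 else 2 * int N - c + 1)
        = (if even d then d + 2 else 2 * int N - d + 1)"
      using int_zigzag[OF c] int_zigzag[OF d] by simp
    then show "c = d"
      using c d by (auto split: if_splits)
  qed
  have "zigzag N c \<in> {1..N}" if c: "c \<in> {0..<int N}" for c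
    using int_zigzag[OF c] c by (auto split: if_splits)
  then have "zigzag N ` {0..<int N} \<subseteq> {1..N}"
    by blast
  then have "zigzag N ` {0..<int N} = {1..N}"
    by (intro card_subset_eq) (simp_all add: card_image[OF inj])
  with inj show ?thesis by (simp add: bij_betw_def)
qed

text \<open>With c1, c4 even and c2, c3 odd, the doubled labels add up to (c1 + c4 + 4) + (4N + 2 -
  c2 - c3) = 4N + 6; the other case is symmetric.\<close>

lemma sum_zigzag:
  assumes c: "c1 \<in> {0..<int N}" "c2 \<in> {0..<int N}" "c3 \<in> {0..<int N}" "c4 \<in> {0..<int N}"
    and "c1 + c4 = c2 + c3" "even c1 \<longleftrightarrow> even c4" "even c2 \<longleftrightarrow> odd c1"
  shows "zigzag N c1 + zigzag N c2 + zigzag N c3 + zigzag N c4 = 2 * N + 3"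
proof -
  have "even c3 \<longleftrightarrow> even c2"
    using assms(5,6) by presburger
  then have "2 * int (zigzag N c1 + zigzag N c2 + zigzag N c3 + zigzag N c4) = 2 * int (2 * N + 3)"
    using int_zigzag[OF c(1)] int_zigzag[OF c(2)] int_zigzag[OF c(3)] int_zigzag[OF c(4)] assms(5-7)
    by (cases "even c1") (simp_all add: algebra_simps)
  then show ?thesis by (simp only: mult_cancel_left of_nat_eq_iff) simp
qed

definition centered :: "nat \<Rightarrow> nat \<Rightarrow> int" where
  "centered m i = int i - int (m div 2) - 1"

lemma bij_betw_centered:
  assumes "odd m"
  shows "bij_betw (centered m) {1..m} (sym_interval (m div 2))"
proof -
  have "int m = 2 * int (m div 2) + 1"
    using assms by (auto elim!: oddE)
  then show ?thesis
    by (intro bij_betwI[where g = "\<lambda>u. nat (u + int (m div 2) + 1)"])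
       (auto simp: centered_def sym_interval_def)
qed

lemma centered_reflect:
  assumes "odd m" "i \<in> {1..m}"
  shows "centered m (m + 1 - i) = - centered m i"
  using assms by (auto simp: centered_def elim!: oddE)

definition grid_value :: "nat \<Rightarrow> nat \<Rightarrow> (int \<Rightarrow> int) \<Rightarrow> (int \<Rightarrow> int) \<Rightarrow> nat \<times> nat \<Rightarrow> int" where
  "grid_value m n P Q = (\<lambda>(i, j). int (m * n div 2) + (P (centered m i) + Q (centered n j)))"

definition arrangement_labeling ::
  "nat \<Rightarrow> nat \<Rightarrow> (int \<Rightarrow> int) \<Rightarrow> (int \<Rightarrow> int) \<Rightarrow> nat \<times> nat \<Rightarrow> nat" where
  "arrangement_labeling m n P Q =
     restrict (zigzag (m * n) \<circ> grid_value m n P Q) (proj_vertices m n)"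

text \<open>A chain of bijections: the arrangements lead from vertices to
  \<open>A \<times> B\<close>, the tiling to [-H, H], and adding H to 0, ..., mn - 1, as mn = 2H +
  1.\<close>

lemma bij_betw_grid_value:
  assumes mn: "odd m" "odd n"
    and t: "symmetric_tiling (m * n div 2) A B"
    and PQ: "P \<in> odd_arrangements (m div 2) A" "Q \<in> odd_arrangements (n div 2) B"
  shows "bij_betw (grid_value m n P Q) (proj_vertices m n) {0..<int (m * n)}"
proof -
  let ?H = "int (m * n div 2)"
  have P: "bij_betw (P \<circ> centered m) {1..m} A" and Q: "bij_betw (Q \<circ> centered n) {1..n} B"
    using PQ bij_betw_trans[OF bij_betw_centered[OF mn(1)]] bij_betw_trans[OF bij_betw_centered[OF mn(2)]]
    unfolding odd_arrangements_def by blast+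
  have 1: "bij_betw (map_prod (P \<circ> centered m) (Q \<circ> centered n)) (proj_vertices m n) (A \<times> B)"
    unfolding proj_vertices_def using P Q
    by (simp add: bij_betw_def map_prod_inj_on map_prod_surj_on)
  have 2: "bij_betw (\<lambda>(a, b). a + b) (A \<times> B) (sym_interval (m * n div 2))"
    using t by (simp add: symmetric_tiling_def)
  have N: "int (m * n) = 2 * ?H + 1"
    using mn by (metis even_mult_iff odd_two_times_div_two_succ of_nat_1 of_nat_add of_nat_mult of_nat_numeral)
  have 3: "bij_betw ((+) ?H) (sym_interval (m * n div 2)) {0..<int (m * n)}"
    unfolding N by (rule bij_betwI[where g = "\<lambda>x. x - ?H"]) (auto simp: sym_interval_def)
  have "grid_value m n P Q = (+) ?H \<circ> ((\<lambda>(a, b). a + b) \<circ>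
      map_prod (P \<circ> centered m) (Q \<circ> centered n))"
    by (auto simp: grid_value_def fun_eq_iff)
  then show ?thesis
    using 1 2 3 by (auto intro: bij_betw_trans)
qed

lemma arrangement_labeling_in_C4_face_magic_labelings:
  assumes mn: "odd m" "odd n" "m > 1" "n > 1"
    and t: "symmetric_tiling (m * n div 2) A B"
    and PQ: "P \<in> odd_arrangements (m div 2) A" "Q \<in> odd_arrangements (n div 2) B"
  shows "arrangement_labeling m n P Q \<in> C4_face_magic_labelings m n (2 * m * n + 3)"
proof -
  let ?V = "proj_vertices m n" and ?f = "arrangement_labeling m n P Q"
  let ?c = "grid_value m n P Q"
  have bij: "bij_betw ?f ?V {1..m * n}"
  proof -
    have "bij_betw (zigzag (m * n) \<circ> ?c) ?V {1..m * n}"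
      using bij_betw_grid_value[OF mn(1,2) t PQ] bij_betw_zigzag by (rule bij_betw_trans)
    then show ?thesis
      by (rule bij_betw_cong[THEN iffD1, rotated]) (simp add: arrangement_labeling_def)
  qed
  have c_in: "?c v \<in> {0..<int (m * n)}" if "v \<in> ?V" for v
    using bij_betwE[OF bij_betw_grid_value[OF mn(1,2) t PQ]] that by blast
  \<comment> \<open>The face splits into the pairs v1, v4 and v2, v3 of equal sum, one pair even and
    the other odd.\<close>
  have face_sum: "?f v1 + ?f v2 + ?f v3 + ?f v4 = 2 * m * n + 3"
    if "v1 \<in> ?V" "v2 \<in> ?V" "v3 \<in> ?V" "v4 \<in> ?V" "?c v1 + ?c v4 = ?c v2 + ?c v3"
      "even (?c v1) \<longleftrightarrow> even (?c v4)" "even (?c v2) \<longleftrightarrow> odd (?c v1)" for v1 v2 v3 v4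
    using sum_zigzag[of "?c v1" "m * n" "?c v2" "?c v3" "?c v4"] that c_in
    by (simp add: arrangement_labeling_def mult.assoc)
  have P_even: "even (P (centered m i)) \<longleftrightarrow> even (centered m i)" if "i \<in> {1..m}" for i
    using PQ(1) bij_betwE[OF bij_betw_centered[OF mn(1)]] that by (auto simp: odd_arrangements_def)
  have Q_even: "even (Q (centered n j)) \<longleftrightarrow> even (centered n j)" if "j \<in> {1..n}" for j
    using PQ(2) bij_betwE[OF bij_betw_centered[OF mn(2)]] that by (auto simp: odd_arrangements_def)
  \<comment> \<open>\<open>P\<close> and \<open>Q\<close> preserve parity, so up to a fixed shift
    the parity of the grid value is that of i + j.\<close>
  have parity: "even (?c (i, j)) \<longleftrightarrow> even (m * n div 2 + m div 2 + n div 2 + i + j)"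
    if "(i, j) \<in> ?V" for i j
  proof -
    have "i \<in> {1..m}" "j \<in> {1..n}"
      using that by (auto simp: proj_vertices_def)
    then have "even (?c (i, j)) \<longleftrightarrow> even (int (m * n div 2) + centered m i + centered n j)"
      using P_even[of i] Q_even[of j] by (simp add: grid_value_def) blast
    also have "\<dots> \<longleftrightarrow> even (int (m * n div 2 + m div 2 + n div 2 + i + j))"
      by (simp add: centered_def) blast
    finally show ?thesis by (simp only: even_of_nat)
  qed
  have P_neg: "P (centered m (m + 1 - i)) = - P (centered m i)" if "i \<in> {1..m}" for i
    using PQ(1) centered_reflect[OF mn(1) that] by (simp add: odd_arrangements_def)
  have Q_neg: "Q (centered n (n + 1 - j)) = - Q (centered n j)" if "j \<in> {1..n}" for j
    using PQ(2) centered_reflect[OF mn(2) that] by (simp add: odd_arrangements_def)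
  \<comment> \<open>Vertices exchanged by the central reflection have values with even sum 2H, hence
    of equal parity; a seam face consists of two such pairs.\<close>
  have c_neg: "?c (i, j) + ?c (m + 1 - i, n + 1 - j) = 2 * int (m * n div 2)"
    if "i \<in> {1..m}" "j \<in> {1..n}" for i j
    using P_neg[OF that(1)] Q_neg[OF that(2)] by (simp add: grid_value_def)
  have "(\<Sum>v\<in>F. ?f v) = 2 * m * n + 3" if F: "F \<in> proj_C4_faces m n" for F
  proof -
    consider (interior) i j where "F = {(i, j), (i + 1, j), (i, j + 1), (i + 1, j + 1)}"
        "i \<in> {1..m - 1}" "j \<in> {1..n - 1}"
      | (right) i where "F = {(i, n), (i + 1, n), (m + 1 - i, 1), (m - i, 1)}" "i \<in> {1..m - 1}"
      | (bottom) j where "F = {(m, j), (m, j + 1), (1, n + 1 - j), (1, n - j)}" "j \<in> {1..n - 1}"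
      using F unfolding proj_C4_faces_def by blast
    then show ?thesis
    proof cases
      case interior
      have V: "(i, j) \<in> ?V" "(i + 1, j) \<in> ?V" "(i, j + 1) \<in> ?V" "(i + 1, j + 1) \<in> ?V"
        using interior by (auto simp: proj_vertices_def)
      have "?f (i, j) + ?f (i + 1, j) + ?f (i, j + 1) + ?f (i + 1, j + 1) = 2 * m * n + 3"
      proof (rule face_sum[OF V])
        show "?c (i, j) + ?c (i + 1, j + 1) = ?c (i + 1, j) + ?c (i, j + 1)"
          by (simp add: grid_value_def)
      qed (simp_all only: parity[OF V(1)] parity[OF V(2)] parity[OF V(4)], presburger+)
      then show ?thesis unfolding interior(1) by simp
    next
      case right
      have V: "(i, n) \<in> ?V" "(i + 1, n) \<in> ?V" "(m - i, 1) \<in> ?V" "(m + 1 - i, 1) \<in> ?V"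
        using right mn by (auto simp: proj_vertices_def)
      \<comment> \<open>The pairs of equal sum are (i, n), (m + 1 - i, 1) and (i + 1, n), (m - i,
        1), so the last two vertices of the face change places.\<close>
      have "?f (i, n) + ?f (i + 1, n) + ?f (m - i, 1) + ?f (m + 1 - i, 1) = 2 * m * n + 3"
      proof (rule face_sum[OF V])
        have i: "i \<in> {1..m}" "i + 1 \<in> {1..m}" "n \<in> {1..n}"
          using right mn by auto
        have c: "?c (i, n) + ?c (m + 1 - i, 1) = 2 * int (m * n div 2)"
          using c_neg[OF i(1,3)] by simp
        then show "?c (i, n) + ?c (m + 1 - i, 1) = ?c (i + 1, n) + ?c (m - i, 1)"
          using c_neg[OF i(2,3)] by simp
        have "even (?c (i, n) + ?c (m + 1 - i, 1))"
          unfolding c by simp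
        then show "even (?c (i, n)) \<longleftrightarrow> even (?c (m + 1 - i, 1))"
          by (simp only: even_add)
      qed (simp_all only: parity[OF V(1)] parity[OF V(2)], presburger)
      \<comment> \<open>The sum over the set splits into four terms only for distinct vertices;
        \<open>Suc m - i\<close> is the simplified form of \<open>m + 1 - i\<close>.\<close>
      moreover have "Suc m - i \<noteq> m - i"
        using right(2) by auto
      ultimately show ?thesis unfolding right(1) using mn by simp
    next
      case bottom
      have V: "(m, j) \<in> ?V" "(m, j + 1) \<in> ?V" "(1, n - j) \<in> ?V" "(1, n + 1 - j) \<in> ?V"
        using bottom mn by (auto simp: proj_vertices_def)
      have "?f (m, j) + ?f (m, j + 1) + ?f (1, n - j) + ?f (1, n + 1 - j) = 2 * m * n + 3"
      proof (rule face_sum[OF V])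
        have j: "m \<in> {1..m}" "j \<in> {1..n}" "j + 1 \<in> {1..n}"
          using bottom mn by auto
        have c: "?c (m, j) + ?c (1, n + 1 - j) = 2 * int (m * n div 2)"
          using c_neg[OF j(1,2)] by simp
        then show "?c (m, j) + ?c (1, n + 1 - j) = ?c (m, j + 1) + ?c (1, n - j)"
          using c_neg[OF j(1,3)] by simp
        have "even (?c (m, j) + ?c (1, n + 1 - j))"
          unfolding c by simp
        then show "even (?c (m, j)) \<longleftrightarrow> even (?c (1, n + 1 - j))"
          by (simp only: even_add)
      qed (simp_all only: parity[OF V(1)] parity[OF V(2)], presburger)
      moreover have "Suc n - j \<noteq> n - j"
        using bottom(2) by auto
      ultimately show ?thesis unfolding bottom(1) using mn by simp
    qed
  qed
  with bij show ?thesis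
    by (simp add: C4_face_magic_labelings_def arrangement_labeling_def)
qed

text \<open>\<open>zigzag\<close> is injective, so the sums P u + Q v agree. Odd functions vanish at
  0, so setting v = 0 or u = 0 isolates \<open>P\<close> or \<open>Q\<close>, whose images are
  \<open>A\<close> and \<open>B\<close>.\<close>

lemma arrangement_labeling_eqD:
  assumes mn: "odd m" "odd n"
    and t: "symmetric_tiling (m * n div 2) A B" "symmetric_tiling (m * n div 2) A' B'"
    and PQ: "P \<in> odd_arrangements (m div 2) A" "Q \<in> odd_arrangements (n div 2) B"
    and PQ': "P' \<in> odd_arrangements (m div 2) A'" "Q' \<in> odd_arrangements (n div 2) B'"
    and eq: "arrangement_labeling m n P Q = arrangement_labeling m n P' Q'"
  shows "A = A' \<and> B = B' \<and> P = P' \<and> Q = Q'"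
proof -
  have *: "P u + Q v = P' u + Q' v"
    if uv: "u \<in> sym_interval (m div 2)" "v \<in> sym_interval (n div 2)" for u v
  proof -
    obtain i j where ij: "i \<in> {1..m}" "j \<in> {1..n}" "centered m i = u" "centered n j = v"
      using uv bij_betw_imp_surj_on[OF bij_betw_centered[OF mn(1)]]
        bij_betw_imp_surj_on[OF bij_betw_centered[OF mn(2)]]
      by (metis imageE)
    then have V: "(i, j) \<in> proj_vertices m n"
      by (simp add: proj_vertices_def)
    have "grid_value m n P Q (i, j) = grid_value m n P' Q' (i, j)"
    proof (rule inj_onD[OF bij_betw_imp_inj_on[OF bij_betw_zigzag]])
      show "zigzag (m * n) (grid_value m n P Q (i, j)) = zigzag (m * n) (grid_value m n P' Q' (i, j))"
        using fun_cong[OF eq, of "(i, j)"] V by (simp add: arrangement_labeling_def)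
      show "grid_value m n P Q (i, j) \<in> {0..<int (m * n)}"
        using bij_betwE[OF bij_betw_grid_value[OF mn t(1) PQ]] V by blast
      show "grid_value m n P' Q' (i, j) \<in> {0..<int (m * n)}"
        using bij_betwE[OF bij_betw_grid_value[OF mn t(2) PQ']] V by blast
    qed
    then show ?thesis
      using ij by (simp add: grid_value_def)
  qed
  have zero: "R 0 = 0" if "R \<in> odd_arrangements p C" for R p C
  proof -
    have "R (- 0) = - R 0"
      using that unfolding odd_arrangements_def by blast
    then show ?thesis by simp
  qed
  have outside: "R u = 0" if "R \<in> odd_arrangements p C" "u \<notin> sym_interval p" for R p C u
    using that by (simp add: odd_arrangements_def)
  have P: "P = P'"
  proof
    fix u show "P u = P' u"
    proof (cases "u \<in> sym_interval (m div 2)")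
      case True
      then show ?thesis
        using *[OF True, of 0] zero[OF PQ(2)] zero[OF PQ'(2)] by (simp add: sym_interval_def)
    next
      case False
      then show ?thesis using outside[OF PQ(1)] outside[OF PQ'(1)] by simp
    qed
  qed
  have Q: "Q = Q'"
  proof
    fix v show "Q v = Q' v"
    proof (cases "v \<in> sym_interval (n div 2)")
      case True
      then show ?thesis
        using *[OF _ True, of 0] zero[OF PQ(1)] zero[OF PQ'(1)] by (simp add: sym_interval_def)
    next
      case False
      then show ?thesis using outside[OF PQ(2)] outside[OF PQ'(2)] by simp
    qed
  qed
  show ?thesis
    using P Q PQ PQ' by (auto simp: odd_arrangements_def bij_betw_def)
qed

section \<open>Counting labelings and their symmetry classes\<close>

lemma finite_C4_face_magic_labelings: "finite (C4_face_magic_labelings m n S)"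
proof (rule finite_subset)
  show "C4_face_magic_labelings m n S \<subseteq> proj_vertices m n \<rightarrow>\<^sub>E {1..m * n}"
    by (auto simp: C4_face_magic_labelings_def PiE_def bij_betw_def)
  show "finite (proj_vertices m n \<rightarrow>\<^sub>E {1..m * n})"
    by (intro finite_PiE) (auto simp: proj_vertices_def)
qed

text \<open>Every sized tiling admits at least as many pairs of arrangements as the product of the
  two bounds, and a labeling determines its tiling and its pair, so the contributions add
  up.\<close>

lemma card_C4_face_magic_labelings_ge:
  assumes mn: "odd m" "odd n" "m > 1" "n > 1"
  shows "(tau m n + tau n m) * (2 ^ (m div 2) * beta m * (2 ^ (n div 2) * beta n))
    \<le> card (C4_face_magic_labelings m n (2 * m * n + 3))"
proof -
  let ?X = "\<lambda>(A, B). odd_arrangements (m div 2) A \<times> odd_arrangements (n div 2) B"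
  let ?T = "sized_tilings m n"
  let ?b = "2 ^ (m div 2) * beta m * (2 ^ (n div 2) * beta n)"
  have fin: "finite A" "finite B" if "(A, B) \<in> ?T" for A B
    using that mn by (auto simp: sized_tilings_def intro!: card_ge_0_finite)
  have finX: "finite (?X t)" if "t \<in> ?T" for t
    using that fin by (cases t) (auto intro!: finite_odd_arrangements)
  have "?b \<le> card (?X t)" if t: "t \<in> ?T" for t
  proof -
    obtain A B where AB: "t = (A, B)"
      by (cases t)
    have tiling: "symmetric_tiling (m * n div 2) A B"
      and cards: "card A = 2 * (m div 2) + 1" "card B = 2 * (n div 2) + 1"
      using t AB mn by (auto simp: sized_tilings_def)
    have "2 ^ (m div 2) * beta m \<le> card (odd_arrangements (m div 2) A)"
      unfolding beta_altdef[OF mn(1)] using tiling fin(1) t AB cards(1)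
      by (intro card_odd_arrangements_ge) auto
    moreover have "2 ^ (n div 2) * beta n \<le> card (odd_arrangements (n div 2) B)"
      unfolding beta_altdef[OF mn(2)] using symmetric_tiling_commute[OF tiling] fin(2) t AB cards(2)
      by (intro card_odd_arrangements_ge) auto
    ultimately show ?thesis
      unfolding AB by (simp add: card_cartesian_product mult_le_mono)
  qed
  then have "card ?T * ?b \<le> (\<Sum>t\<in>?T. card (?X t))"
    using sum_bounded_below[of ?T ?b "\<lambda>t. card (?X t)"] by simp
  also have "\<dots> = card (Sigma ?T ?X)"
    using tau_le_card_sized_tilings(1)[OF mn] finX by (simp add: card_SigmaI)
  also have "\<dots> \<le> card (C4_face_magic_labelings m n (2 * m * n + 3))"
  proof (rule card_inj_on_le[where f = "\<lambda>(t, P, Q). arrangement_labeling m n P Q"])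
    show "inj_on (\<lambda>(t, P, Q). arrangement_labeling m n P Q) (Sigma ?T ?X)"
    proof (rule inj_onI)
      fix x y assume xy: "x \<in> Sigma ?T ?X" "y \<in> Sigma ?T ?X"
        "(\<lambda>(t, P, Q). arrangement_labeling m n P Q) x = (\<lambda>(t, P, Q). arrangement_labeling m n P Q) y"
      obtain A B P Q A' B' P' Q' where x: "x = ((A, B), P, Q)" and y: "y = ((A', B'), P', Q')"
        by (metis surj_pair)
      have "(A, B) \<in> ?T" "(A', B') \<in> ?T"
        and arr: "P \<in> odd_arrangements (m div 2) A" "Q \<in> odd_arrangements (n div 2) B"
        "P' \<in> odd_arrangements (m div 2) A'" "Q' \<in> odd_arrangements (n div 2) B'"
        "arrangement_labeling m n P Q = arrangement_labeling m n P' Q'"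
        using xy unfolding x y prod.case by blast+
      then show "x = y"
        unfolding x y using arrangement_labeling_eqD[OF mn(1,2) _ _ arr] by (simp add: sized_tilings_def)
    qed
    show "(\<lambda>(t, P, Q). arrangement_labeling m n P Q) ` Sigma ?T ?X
        \<subseteq> C4_face_magic_labelings m n (2 * m * n + 3)"
      using arrangement_labeling_in_C4_face_magic_labelings[OF mn]
      by (auto simp: sized_tilings_def)
  qed (rule finite_C4_face_magic_labelings)
  finally show ?thesis
    using mult_le_mono1[OF tau_le_card_sized_tilings(2)[OF mn], of ?b] by linarith
qed

text \<open>Needed for the complement: the constant \<open>m * n + 1\<close> must be summed over
  exactly four labeled vertices.\<close>

lemma proj_C4_faceD:
  assumes "F \<in> proj_C4_faces m n" "m > 1" "n > 1"
  shows "card F = 4" and "F \<subseteq> proj_vertices m n"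
  using assms by (auto simp: proj_C4_faces_def proj_vertices_def card_insert_if)

text \<open>On four vertices the complement has sum 4(mn + 1) - (2mn + 3) = 2mn + 1.\<close>

lemma complement_C4_face_magic_labelings:
  assumes mn: "m > 1" "n > 1" and f: "f \<in> C4_face_magic_labelings m n (2 * m * n + 3)"
  shows "restrict (\<lambda>v. m * n + 1 - f v) (proj_vertices m n)
    \<in> C4_face_magic_labelings m n (2 * m * n + 1)"
proof -
  let ?V = "proj_vertices m n" and ?g = "\<lambda>v. m * n + 1 - f v"
  have bij: "bij_betw f ?V {1..m * n}"
    and sum: "\<forall>F\<in>proj_C4_faces m n. (\<Sum>v\<in>F. f v) = 2 * m * n + 3"
    using f by (auto simp: C4_face_magic_labelings_def)
  have le: "f v \<le> m * n + 1" if "v \<in> ?V" for v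
    using bij_betwE[OF bij] that by fastforce
  have "bij_betw (\<lambda>x. m * n + 1 - x) {1..m * n} {1..m * n}"
    by (rule bij_betwI[where g = "\<lambda>x. m * n + 1 - x"]) auto
  from bij_betw_trans[OF bij this] have "bij_betw (restrict ?g ?V) ?V {1..m * n}"
    by (rule bij_betw_cong[THEN iffD1, rotated]) simp
  moreover have "(\<Sum>v\<in>F. restrict ?g ?V v) = 2 * m * n + 1" if F: "F \<in> proj_C4_faces m n" for F
  proof -
    have sub: "F \<subseteq> ?V" and card: "card F = 4"
      using proj_C4_faceD[OF F mn] by auto
    have "(\<Sum>v\<in>F. restrict ?g ?V v) + (\<Sum>v\<in>F. f v) = (\<Sum>v\<in>F. m * n + 1)"
      unfolding sum.distrib[symmetric] using sub le by (intro sum.cong) auto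
    also have "\<dots> = 4 * (m * n + 1)"
      using card by simp
    finally show ?thesis
      using sum F by simp
  qed
  ultimately show ?thesis
    by (simp add: C4_face_magic_labelings_def)
qed

text \<open>Labels lie between 1 and mn, so the subtraction is exact and complementing is
  injective.\<close>

lemma card_C4_face_magic_labelings_complement:
  assumes "m > 1" "n > 1"
  shows "card (C4_face_magic_labelings m n (2 * m * n + 3))
    \<le> card (C4_face_magic_labelings m n (2 * m * n + 1))"
proof (rule card_inj_on_le[where f = "\<lambda>f. restrict (\<lambda>v. m * n + 1 - f v) (proj_vertices m n)"])
  let ?L = "C4_face_magic_labelings m n (2 * m * n + 3)"
  show "inj_on (\<lambda>f. restrict (\<lambda>v. m * n + 1 - f v) (proj_vertices m n)) ?L"
  proof (rule inj_onI)
    fix f g assume fg: "f \<in> ?L" "g \<in> ?L"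
      and eq: "restrict (\<lambda>v. m * n + 1 - f v) (proj_vertices m n)
        = restrict (\<lambda>v. m * n + 1 - g v) (proj_vertices m n)"
    show "f = g"
    proof (rule extensionalityI[of _ "proj_vertices m n"])
      fix v assume v: "v \<in> proj_vertices m n"
      then have "f v \<in> {1..m * n}" "g v \<in> {1..m * n}"
        using fg by (auto simp: C4_face_magic_labelings_def dest: bij_betwE)
      then show "f v = g v"
        using fun_cong[OF eq, of v] v by auto
    qed (use fg in \<open>auto simp: C4_face_magic_labelings_def\<close>)
  qed
  show "(\<lambda>f. restrict (\<lambda>v. m * n + 1 - f v) (proj_vertices m n)) ` ?L
      \<subseteq> C4_face_magic_labelings m n (2 * m * n + 1)"
    using complement_C4_face_magic_labelings[OF assms] by blast
qed (rule finite_C4_face_magic_labelings)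

text \<open>A class lies among the compositions of one labeling with the four symmetries, and
  reflexivity makes the classes cover all labelings.\<close>

lemma card_C4_face_magic_labelings_le:
  "card (C4_face_magic_labelings m n S) \<le> 4 * num_C4_face_magic_labelings m n S"
proof -
  let ?L = "C4_face_magic_labelings m n S" and ?R = "labeling_equiv m n S"
  have "card (?R `` {f}) \<le> 4" for f
  proof -
    let ?I = "(\<lambda>\<sigma>. restrict (f \<circ> \<sigma>) (proj_vertices m n)) ` proj_symmetries m n"
    have fin: "finite (proj_symmetries m n)" and "card (proj_symmetries m n) \<le> 4"
      by (simp_all add: proj_symmetries_def card_insert_if)
    have "g \<in> ?I" if g: "(f, g) \<in> ?R" for g
    proof -
      obtain \<sigma> where \<sigma>: "\<sigma> \<in> proj_symmetries m n" "\<forall>v\<in>proj_vertices m n. g v = f (\<sigma> v)"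
        and "g \<in> extensional (proj_vertices m n)"
        using g by (auto simp: labeling_equiv_def C4_face_magic_labelings_def)
      then have "g = restrict (f \<circ> \<sigma>) (proj_vertices m n)"
        by (intro extensionalityI[of _ "proj_vertices m n"]) auto
      with \<sigma> show ?thesis by blast
    qed
    then have "?R `` {f} \<subseteq> ?I"
      by blast
    then have "card (?R `` {f}) \<le> card ?I"
      using fin by (intro card_mono) auto
    also have "\<dots> \<le> 4"
      using card_image_le[OF fin] \<open>card (proj_symmetries m n) \<le> 4\<close> le_trans by blast
    finally show ?thesis .
  qed
  then have le: "card C \<le> 4" if "C \<in> ?L // ?R" for C
    using that by (auto simp: quotient_def)
  have refl: "(f, f) \<in> ?R" if "f \<in> ?L" for f
    using that by (auto simp: labeling_equiv_def proj_symmetries_def)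
  have "?L \<subseteq> \<Union> (?L // ?R)"
    using refl by (auto simp: quotient_def)
  moreover have "finite (\<Union> (?L // ?R))"
    by (rule finite_subset[OF _ finite_C4_face_magic_labelings[of m n S]])
       (auto simp: quotient_def labeling_equiv_def)
  ultimately have "card ?L \<le> card (\<Union> (?L // ?R))"
    by (rule card_mono[rotated])
  also have "\<dots> \<le> (\<Sum>C\<in>?L // ?R. card C)"
    by (rule card_Union_le_sum_card)
  also have "\<dots> \<le> 4 * card (?L // ?R)"
    using sum_bounded_above[of "?L // ?R" card 4] le by simp
  finally show ?thesis
    by (simp add: num_C4_face_magic_labelings_def)
qed

theorem theorem42:
  fixes m n :: nat
  assumes "m \<ge> 3" and "n \<ge> 3" and "odd m" and "odd n" and "m \<noteq> n"
  shows "num_C4_face_magic_labelings m n (2 * m * n + 1)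
           \<ge> (tau m n + tau n m) * 2 ^ ((m + n) div 2 - 3) * beta m * beta n \<and>
         num_C4_face_magic_labelings m n (2 * m * n + 3)
           \<ge> (tau m n + tau n m) * 2 ^ ((m + n) div 2 - 3) * beta m * beta n"
proof -
  let ?t = "tau m n + tau n m"
  have mn: "m > 1" "n > 1"
    using assms by auto
  have "m + n \<noteq> 6"
    using assms by auto
  \<comment> \<open>For odd m and n, (m - 1)/2 + (n - 1)/2 = (m + n)/2 - 1, two more than the
    exponent of the bound; the spare factor 4 pays for the four symmetries.\<close>
  then have "m div 2 + n div 2 = 2 + ((m + n) div 2 - 3)"
    using assms by (auto elim!: oddE)
  then have "(2::nat) ^ (m div 2) * 2 ^ (n div 2) = 2 ^ 2 * 2 ^ ((m + n) div 2 - 3)"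
    unfolding power_add[symmetric] by simp
  then have "?t * (2 ^ (m div 2) * beta m * (2 ^ (n div 2) * beta n))
      = 4 * (?t * 2 ^ ((m + n) div 2 - 3) * beta m * beta n)"
    by (simp add: algebra_simps)
  then show ?thesis
    using card_C4_face_magic_labelings_ge[OF assms(3,4) mn]
      card_C4_face_magic_labelings_complement[OF mn]
      card_C4_face_magic_labelings_le[of m n "2 * m * n + 1"]
      card_C4_face_magic_labelings_le[of m n "2 * m * n + 3"]
    by linarith
qed

end
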